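(* Let $c$ be a constraint over variables with domain $[1,d]$. Then unit-propagation on the range encoding of $c$ (with $c$ required to hold) enforces range consistency on $c$.
   Context: Constraints. Variables have domain $[1,d]=\{1,\dots,d\}$. A constraint $c$ has a scope $\mathrm{scope}(c)=(v_1,\dots,v_n)$ of variables and a relation $\mathrm{range}(c)\subseteq[1,d]^n$ of allowed tuples. Given current domains $D(v)\subseteq[1,d]$, a bound support for $v_i=a$ is an allowed tuple with $i$-th entry $a$ and, for every $j\neq i$, $j$-th entry in the interval $[\min D(v_j),\max D(v_j)]$. The constraint is range consistent iff for every $v_i\in\mathrm{scope}(c)$ and every $a\in D(v_i)$ there is a bound support for $v_i=a$. Enforcing range consistency means replacing the domains by the largest subdomains for which $c$ is range consistent; failure means that some domain becomes empty. Logic programs and unit-propagation. A rule $h\leftarrow a_1,\dots,a_m,\mathit{not}\,a_{m+1},\dots,\mathit{not}\,a_k$ has head $h$ and body the set of literals on its right; $\bot$ is the always-false atom. Unit-propagation works on partial truth assignments to atoms and rule bodies, using the nogoods (forbidden sets of truth-value assignments) expressing that: a body is true iff its literals are all true; a true body makes its head true; an atom is true only if the body of some rule having it in its head is true; $\bot$ is false. Whenever all but one element of a nogood hold, the complement of the remaining element is added; a conflict occurs if all elements of some nogood hold. Range encoding of $c$. For each $v\in\mathrm{scope}(c)$ and each interval $[l,u]\subseteq[1,d]$ with $l\le u$ there is an atom $r(v,l,u)$ (meaning $v\in[l,u]$), and the rules $r(v,l,u)\leftarrow \mathit{not}\,r(v,1,l-1),\mathit{not}\,r(v,u+1,d)$;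 $\bot\leftarrow r(v,l,u),\mathit{not}\,r(v,l-1,u)$ (for $l>1$); $\bot\leftarrow r(v,l,u),\mathit{not}\,r(v,l,u+1)$ (for $u<d$), where literals $\mathit{not}\,r(v,1,0)$ and $\mathit{not}\,r(v,d+1,d)$ for empty ranges are taken as true (omitted). In addition there are the rules $sat(c)\leftarrow\mathit{not}\,violate(c)$ and $violate(c)\leftarrow\mathit{not}\,sat(c)$, and, for every conflict region of $c$, i.e. every box $[l_1,u_1]\times\cdots\times[l_n,u_n]$ of intervals in $[1,d]$ that contains no allowed tuple, the rule $violate(c)\leftarrow r(v_1,l_1,u_1),\dots,r(v_n,l_n,u_n)$. Enforcing a consistency by unit-propagation. Given nonempty initial domains $D(v)\subseteq[1,d]$, start from the assignment in which $violate(c)$ is false and $r(v,i,i)$ is false for all $i\notin D(v)$, and run unit-propagation to fixpoint. That unit-propagation enforces range consistency means: for all such initial domains, a conflict occurs iff enforcing range consistency fails, and otherwise, for every $v$, the set of $i$ with $r(v,i,i)$ not false at the fixpoint equals the domain of $v$ obtained by enforcing range consistency.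
   Formalization: The scope of c is assumed to be a nonempty tuple of pairwise distinct variables; with a repeated variable (scope (v,v), allowed tuples (1,2),(2,1), d=2) or an empty scope with empty relation the claim fails as literally defined. *)

theory Defs
  imports Main
begin

record 'v constr =
  scope :: "'v list"
  allowed :: "nat list set"

text \<open>Distinctness matters: \<open>bound_support\<close> treats positions independently, whereas a rule body of
  the encoding identifies equal literals of a repeated variable.\<close>

definition wf_constr :: "nat \<Rightarrow> 'v constr \<Rightarrow> bool" where
  "wf_constr d c \<longleftrightarrow>
     scope c \<noteq> [] \<and> distinct (scope c) \<and>
     allowed c \<subseteq> {t. length t = length (scope c) \<and> set t \<subseteq> {1..d}}"

text \<open>The interval from the minimum to the maximum of an empty domain is empty;
  \<open>Min\<close> and \<open>Max\<close> are unspecified there.\<close>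

definition hull :: "nat set \<Rightarrow> nat set" where
  "hull A = (if A = {} then {} else {Min A..Max A})"

definition bound_support :: "'v constr \<Rightarrow> ('v \<Rightarrow> nat set) \<Rightarrow> nat \<Rightarrow> nat \<Rightarrow> nat list \<Rightarrow> bool" where
  "bound_support c D i a t \<longleftrightarrow>
     t \<in> allowed c \<and> t ! i = a \<and>
     (\<forall>j<length (scope c). j \<noteq> i \<longrightarrow> t ! j \<in> hull (D (scope c ! j)))"

definition range_consistent :: "'v constr \<Rightarrow> ('v \<Rightarrow> nat set) \<Rightarrow> bool" where
  "range_consistent c D \<longleftrightarrow>
     (\<forall>i<length (scope c). \<forall>a\<in>D (scope c ! i). \<exists>t. bound_support c D i a t)"

text \<open>The order on domain assignments is pointwise inclusion. Variables outside the scope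
  simply keep their domain.\<close>

definition enforce_rc :: "'v constr \<Rightarrow> ('v \<Rightarrow> nat set) \<Rightarrow> 'v \<Rightarrow> nat set" where
  "enforce_rc c D = (GREATEST E. E \<le> D \<and> range_consistent c E)"

lemma hull_mono: "hull A \<subseteq> hull B" if "A \<subseteq> B" "finite B"
proof (cases "A = {}")
  case False
  then have "Min B \<le> Min A" "Max A \<le> Max B" "B \<noteq> {}"
    using that by (auto intro: Min_antimono Max_mono)
  then show ?thesis using False by (auto simp: hull_def)
qed (simp add: hull_def)

text \<open>A greatest range consistent family of subdomains exists, so \<open>enforce_rc\<close> is well defined.\<close>

lemma enforce_rc_greatest:
  assumes fin: "\<And>v. v \<in> set (scope c) \<Longrightarrow> finite (D v)"
  shows "enforce_rc c D \<le> D" and "range_consistent c (enforce_rc c D)"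
    and "\<And>E. E \<le> D \<Longrightarrow> range_consistent c E \<Longrightarrow> E \<le> enforce_rc c D"
proof -
  define S where "S = Sup {E. E \<le> D \<and> range_consistent c E}"
  have le: "S \<le> D" unfolding S_def by (rule Sup_least) simp
  have ub: "E \<le> S" if "E \<le> D" "range_consistent c E" for E
    unfolding S_def using that by (intro Sup_upper) simp
  have rc: "range_consistent c S"
    unfolding range_consistent_def
  proof (intro allI impI ballI)
    fix i a assume i: "i < length (scope c)" and "a \<in> S (scope c ! i)"
    then obtain E where E: "E \<le> D" "range_consistent c E" "a \<in> E (scope c ! i)"
      unfolding S_def by auto
    then obtain t where t: "bound_support c E i a t"
      using i unfolding range_consistent_def by blast
    have "hull (E (scope c ! j)) \<subseteq> hull (S (scope c ! j))" if j: "j < length (scope c)" for j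
    proof (rule hull_mono)
      show "E (scope c ! j) \<subseteq> S (scope c ! j)" using ub[OF E(1,2)] by (simp add: le_fun_def)
      show "finite (S (scope c ! j))"
        using fin[of "scope c ! j"] le j by (auto simp: le_fun_def intro: finite_subset)
    qed
    then have "bound_support c S i a t" using t unfolding bound_support_def by blast
    then show "\<exists>t. bound_support c S i a t" ..
  qed
  have "enforce_rc c D = S"
    unfolding enforce_rc_def by (rule Greatest_equality) (use le rc ub in auto)
  then show "enforce_rc c D \<le> D" "range_consistent c (enforce_rc c D)"
    "\<And>E. E \<le> D \<Longrightarrow> range_consistent c E \<Longrightarrow> E \<le> enforce_rc c D"
    using le rc ub by auto
qed

text \<open>\<open>R v l u\<close> stands for \<open>v\<close> lying in the interval from \<open>l\<close> to \<open>u\<close>.\<close>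

datatype 'v atom = Bot | R 'v nat nat | Sat | Violate

datatype 'v literal = Pos "'v atom" | Neg "'v atom"

datatype 'v rule = Rule (head: "'v atom") (body: "'v literal set")

text \<open>Truth values are assigned to atoms and to rule bodies. An assignment is a set of signed
  items, and so is a nogood. Rules with the same body share its truth value.\<close>

datatype 'v item = Atom "'v atom" | Body "'v literal set"

datatype 'v signed = Tru "'v item" | Fls "'v item"

fun complement :: "'v signed \<Rightarrow> 'v signed" where
  "complement (Tru x) = Fls x"
| "complement (Fls x) = Tru x"

fun lit_holds :: "'v literal \<Rightarrow> 'v signed" where
  "lit_holds (Pos a) = Tru (Atom a)"
| "lit_holds (Neg a) = Fls (Atom a)"

definition body_nogoods :: "'v literal set \<Rightarrow> 'v signed set set" where
  "body_nogoods B =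
     {insert (Fls (Body B)) (lit_holds ` B)} \<union>
     {{Tru (Body B), complement (lit_holds l)} | l. l \<in> B}"

definition nogoods :: "'v rule set \<Rightarrow> 'v signed set set" where
  "nogoods P =
     (\<Union>r\<in>P. body_nogoods (body r)) \<union>
     {{Tru (Body (body r)), Fls (Atom (head r))} | r. r \<in> P} \<union>
     {insert (Tru (Atom a)) {Fls (Body (body r)) | r. r \<in> P \<and> head r = a} | a. True} \<union>
     {{Tru (Atom Bot)}}"

text \<open>Fixpoint of unit-propagation from the assignment \<open>A\<close>. Propagation is not stopped at a
  conflict; the fixpoint contains a violated nogood iff a run stopping at the first conflict
  meets one.\<close>

inductive_set unit_prop :: "'v signed set set \<Rightarrow> 'v signed set \<Rightarrow> 'v signed set"
  for N :: "'v signed set set" and A :: "'v signed set" where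
  init: "s \<in> A \<Longrightarrow> s \<in> unit_prop N A"
| unit: "\<lbrakk>g \<in> N; s \<in> g; \<And>s'. s' \<in> g - {s} \<Longrightarrow> s' \<in> unit_prop N A\<rbrakk>
    \<Longrightarrow> complement s \<in> unit_prop N A"

definition conflict :: "'v signed set set \<Rightarrow> 'v signed set \<Rightarrow> bool" where
  "conflict N A \<longleftrightarrow> (\<exists>g\<in>N. g \<subseteq> A)"

text \<open>The body omits the literals for empty ranges.\<close>

definition range_body :: "nat \<Rightarrow> 'v \<Rightarrow> nat \<Rightarrow> nat \<Rightarrow> 'v literal set" where
  "range_body d v l u =
     (if 1 < l then {Neg (R v 1 (l - 1))} else {}) \<union>
     (if u < d then {Neg (R v (u + 1) d)} else {})"

definition var_rules :: "nat \<Rightarrow> 'v \<Rightarrow> 'v rule set" where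
  "var_rules d v =
     {Rule (R v l u) (range_body d v l u) | l u. 1 \<le> l \<and> l \<le> u \<and> u \<le> d} \<union>
     {Rule Bot {Pos (R v l u), Neg (R v (l - 1) u)} | l u. 1 < l \<and> l \<le> u \<and> u \<le> d} \<union>
     {Rule Bot {Pos (R v l u), Neg (R v l (u + 1))} | l u. 1 \<le> l \<and> l \<le> u \<and> u < d}"

text \<open>The box is the product of the intervals from \<open>l i\<close> to \<open>u i\<close> over the positions \<open>i\<close> of the scope.\<close>

definition conflict_region :: "nat \<Rightarrow> 'v constr \<Rightarrow> (nat \<Rightarrow> nat) \<Rightarrow> (nat \<Rightarrow> nat) \<Rightarrow> bool" where
  "conflict_region d c l u \<longleftrightarrow>
     (\<forall>i<length (scope c). 1 \<le> l i \<and> l i \<le> u i \<and> u i \<le> d) \<and>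
     \<not> (\<exists>t\<in>allowed c. \<forall>i<length (scope c). t ! i \<in> {l i..u i})"

definition range_encoding :: "nat \<Rightarrow> 'v constr \<Rightarrow> 'v rule set" where
  "range_encoding d c =
     (\<Union>v\<in>set (scope c). var_rules d v) \<union>
     {Rule Sat {Neg Violate}, Rule Violate {Neg Sat}} \<union>
     {Rule Violate {Pos (R (scope c ! i) (l i) (u i)) | i. i < length (scope c)} | l u.
        conflict_region d c l u}"

definition initial :: "nat \<Rightarrow> 'v constr \<Rightarrow> ('v \<Rightarrow> nat set) \<Rightarrow> 'v signed set" where
  "initial d c D =
     {Fls (Atom Violate)} \<union>
     {Fls (Atom (R v i i)) | v i. v \<in> set (scope c) \<and> i \<in> {1..d} - D v}"

definition up_enforces_rc :: "nat \<Rightarrow> 'v constr \<Rightarrow> 'v rule set \<Rightarrow> bool" where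
  "up_enforces_rc d c P \<longleftrightarrow>
     (\<forall>D. (\<forall>v\<in>set (scope c). D v \<noteq> {} \<and> D v \<subseteq> {1..d}) \<longrightarrow>
        (let A = unit_prop (nogoods P) (initial d c D) in
           (conflict (nogoods P) A \<longleftrightarrow> (\<exists>v\<in>set (scope c). enforce_rc c D v = {})) \<and>
           (\<not> conflict (nogoods P) A \<longrightarrow>
              (\<forall>v\<in>set (scope c).
                 {i\<in>{1..d}. Fls (Atom (R v i i)) \<notin> A} = enforce_rc c D v))))"

end

theory Submission
  imports Defs
begin

text \<open>Two bounds on the fixpoint of unit-propagation meet at the range consistent domains.
  If a range consistent family of nonempty subdomains \<open>E\<close> is given, a partial assignment read off
  from \<open>E\<close> contains the initial one and is closed under propagation, so propagation is
  conflict-free and never removes a value of \<open>E\<close>. Conversely, at a conflict-free fixpoint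
  let \<open>F v\<close> be the set of values not excluded. Propagation walks inwards over the
  excluded values at both ends of the domain and so makes \<open>R v (Min (F v)) (Max (F v))\<close> true;
  a value without bound support then spans, with these intervals, a conflict region whose
  rule excludes it. So \<open>F\<close> is range consistent.\<close>

section \<open>Unit-propagation\<close>

text \<open>Fixpoint induction with the side condition on a nogood phrased as one inclusion, so that
  soundness reduces to closing a candidate set \<open>M\<close> under single unit steps.\<close>

lemma unit_prop_subset:
  assumes "A \<subseteq> M"
    and "\<And>g s. \<lbrakk>g \<in> N; s \<in> g; g - {s} \<subseteq> M\<rbrakk> \<Longrightarrow> complement s \<in> M"
  shows "unit_prop N A \<subseteq> M"
proof
  fix s assume "s \<in> unit_prop N A"
  then show "s \<in> M"
    by induction (use assms in blast)+
qed

text \<open>A derived \<open>Tru x\<close> comes from a nogood that contains \<open>Fls x\<close>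
  and whose other elements all hold. If \<open>Fls x\<close> holds as well, this nogood is violated.
  The last premise rules out that \<open>Tru x\<close> was merely assumed.\<close>

lemma conflict_if_inconsistent:
  assumes "Tru x \<in> unit_prop N A" "Fls x \<in> unit_prop N A" "Tru x \<notin> A"
  shows "conflict N (unit_prop N A)"
  using assms(1)
proof cases
  case (unit g s)
  then have "s = Fls x" by (cases s) auto
  then have "g \<subseteq> unit_prop N A" using unit assms(2) by blast
  then show ?thesis using unit by (auto simp: conflict_def)
qed (use assms(3) in simp)

section \<open>Unit-propagation through a single rule\<close>

lemma unit_prop_body:
  assumes "r \<in> P" "\<And>l. l \<in> body r \<Longrightarrow> lit_holds l \<in> unit_prop (nogoods P) A"
  shows "Tru (Body (body r)) \<in> unit_prop (nogoods P) A"
proof -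
  have "insert (Fls (Body (body r))) (lit_holds ` body r) \<in> nogoods P"
    using assms(1) by (auto simp: nogoods_def body_nogoods_def)
  from unit_prop.unit[OF this, of "Fls (Body (body r))" A] show ?thesis
    using assms(2) by auto
qed

lemma unit_prop_head:
  assumes "r \<in> P" "\<And>l. l \<in> body r \<Longrightarrow> lit_holds l \<in> unit_prop (nogoods P) A"
  shows "Tru (Atom (head r)) \<in> unit_prop (nogoods P) A"
proof -
  have "{Tru (Body (body r)), Fls (Atom (head r))} \<in> nogoods P"
    using assms(1) by (auto simp: nogoods_def)
  from unit_prop.unit[OF this, of "Fls (Atom (head r))" A] show ?thesis
    using unit_prop_body[OF assms] by auto
qed

text \<open>Backward propagation in two steps: the false head falsifies the body, and a false body
  all of whose literals but one hold falsifies the remaining one.\<close>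

lemma unit_prop_literal:
  assumes "r \<in> P" "Fls (Atom (head r)) \<in> unit_prop (nogoods P) A" "l \<in> body r"
    and "\<And>l'. \<lbrakk>l' \<in> body r; l' \<noteq> l\<rbrakk> \<Longrightarrow> lit_holds l' \<in> unit_prop (nogoods P) A"
  shows "complement (lit_holds l) \<in> unit_prop (nogoods P) A"
proof -
  have "{Tru (Body (body r)), Fls (Atom (head r))} \<in> nogoods P"
    using assms(1) by (auto simp: nogoods_def)
  from unit_prop.unit[OF this, of "Tru (Body (body r))" A]
  have fls: "Fls (Body (body r)) \<in> unit_prop (nogoods P) A"
    using assms(2) by auto
  have "insert (Fls (Body (body r))) (lit_holds ` body r) \<in> nogoods P"
    using assms(1) by (auto simp: nogoods_def body_nogoods_def)
  from unit_prop.unit[OF this, of "lit_holds l" A] show ?thesis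
    using fls assms(3,4) by auto
qed

text \<open>With only one rule for the head, the support nogood of the head has just two elements,
  so a single false literal falsifies first the body and then the head.\<close>

lemma unit_prop_unsupported:
  assumes "r \<in> P" "\<And>r'. \<lbrakk>r' \<in> P; head r' = head r\<rbrakk> \<Longrightarrow> r' = r"
    and "l \<in> body r" "complement (lit_holds l) \<in> unit_prop (nogoods P) A"
  shows "Fls (Atom (head r)) \<in> unit_prop (nogoods P) A"
proof -
  have "{Tru (Body (body r)), complement (lit_holds l)} \<in> nogoods P"
    using assms(1,3) by (auto simp: nogoods_def body_nogoods_def)
  from unit_prop.unit[OF this, of "Tru (Body (body r))" A]
  have fls: "Fls (Body (body r)) \<in> unit_prop (nogoods P) A"
    using assms(4) by auto
  have "insert (Tru (Atom (head r))) {Fls (Body (body r')) | r'. r' \<in> P \<and> head r' = head r} \<in> nogoods P"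
    unfolding nogoods_def by blast
  moreover have "{Fls (Body (body r')) | r'. r' \<in> P \<and> head r' = head r} = {Fls (Body (body r))}"
    using assms(1,2) by auto
  ultimately have "{Tru (Atom (head r)), Fls (Body (body r))} \<in> nogoods P" by simp
  from unit_prop.unit[OF this, of "Tru (Atom (head r))" A] show ?thesis
    using fls by auto
qed

section \<open>Soundness\<close>

text \<open>The body of the rule for \<open>R v l u\<close> excludes exactly the values of \<open>v\<close> outside \<open>{l..u}\<close>, so
  its truth value can be described by the union of the intervals it negates. Atoms that head no
  rule are false.\<close>

fun range_approx :: "nat \<Rightarrow> 'v set \<Rightarrow> ('v \<Rightarrow> nat set) \<Rightarrow> 'v signed \<Rightarrow> bool" where
  "range_approx d V E (Tru (Atom (R v l u))) \<longleftrightarrow>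
     v \<in> V \<and> 1 \<le> l \<and> l \<le> u \<and> u \<le> d \<and> E v \<subseteq> {l..u}"
| "range_approx d V E (Fls (Atom (R v l u))) \<longleftrightarrow>
     (v \<in> V \<and> 1 \<le> l \<and> l \<le> u \<and> u \<le> d \<longrightarrow> E v \<inter> {l..u} = {})"
| "range_approx d V E (Tru (Atom Bot)) \<longleftrightarrow> False"
| "range_approx d V E (Fls (Atom Bot)) \<longleftrightarrow> True"
| "range_approx d V E (Tru (Atom Sat)) \<longleftrightarrow> True"
| "range_approx d V E (Fls (Atom Sat)) \<longleftrightarrow> False"
| "range_approx d V E (Tru (Atom Violate)) \<longleftrightarrow> False"
| "range_approx d V E (Fls (Atom Violate)) \<longleftrightarrow> True"
| "range_approx d V E (Tru (Body B)) \<longleftrightarrow>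
     B \<subseteq> insert (Neg Violate) {Neg (R v l u) | v l u. E v \<inter> {l..u} = {}}"
| "range_approx d V E (Fls (Body B)) \<longleftrightarrow>
     (\<exists>a. Pos a \<in> B) \<or> Neg Sat \<in> B \<or>
     (\<exists>v\<in>V. \<exists>l u. Neg (R v l u) \<in> B \<and> E v \<subseteq> {x. \<exists>l u. Neg (R v l u) \<in> B \<and> x \<in> {l..u}})"

text \<open>A nonempty domain cannot be both inside an interval and disjoint from it. For bodies the
  same clash arises: the intervals negated in a true body miss every domain, whereas in a false body
  without positive literals and \<open>Neg Sat\<close> they cover some domain.\<close>

lemma range_approx_consistent:
  assumes "range_approx d V E (Tru x)" "range_approx d V E (Fls x)"
    and nonempty: "\<And>v. v \<in> V \<Longrightarrow> E v \<noteq> {}"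
  shows False
proof (cases x)
  case (Atom a)
  then show ?thesis
  proof (cases a)
    case (R v l u)
    then show ?thesis using Atom assms by auto
  qed (use Atom assms in auto)
next
  case (Body B)
  then have B: "B \<subseteq> insert (Neg Violate) {Neg (R v l u) | v l u. E v \<inter> {l..u} = {}}"
    using assms(1) by simp
  then obtain v where "v \<in> V" "E v \<subseteq> {x. \<exists>l u. Neg (R v l u) \<in> B \<and> x \<in> {l..u}}"
    using assms(2) Body by auto
  moreover have "E v \<inter> {x. \<exists>l u. Neg (R v l u) \<in> B \<and> x \<in> {l..u}} = {}"
    using B by blast
  ultimately show False using nonempty by blast
qed

text \<open>The intervals negated in the body together make up \<open>{1..d} - {l..u}\<close>. They
  miss \<open>E v\<close> iff \<open>E v\<close> lies inside \<open>{l..u}\<close>, and cover it iff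
  \<open>E v\<close> avoids \<open>{l..u}\<close>.\<close>

lemma range_approx_range_body:
  assumes "v \<in> V" "1 \<le> l" "l \<le> u" "u \<le> d" "E v \<noteq> {}" "E v \<subseteq> {1..d}"
  shows "range_approx d V E (Tru (Body (range_body d v l u))) \<longleftrightarrow> E v \<subseteq> {l..u}" (is ?T)
    and "range_approx d V E (Fls (Body (range_body d v l u))) \<longleftrightarrow> E v \<inter> {l..u} = {}" (is ?F)
proof -
  have "E v \<subseteq> {l..u} \<longleftrightarrow> (1 < l \<longrightarrow> E v \<inter> {1..l - 1} = {}) \<and> (u < d \<longrightarrow> E v \<inter> {u + 1..d} = {})"
  proof
    assume "E v \<subseteq> {l..u}"
    then show "(1 < l \<longrightarrow> E v \<inter> {1..l - 1} = {}) \<and> (u < d \<longrightarrow> E v \<inter> {u + 1..d} = {})"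
      by fastforce
  next
    assume *: "(1 < l \<longrightarrow> E v \<inter> {1..l - 1} = {}) \<and> (u < d \<longrightarrow> E v \<inter> {u + 1..d} = {})"
    show "E v \<subseteq> {l..u}"
    proof
      fix x assume x: "x \<in> E v"
      then have "x \<in> {1..d}" using assms(6) by blast
      moreover have "x \<notin> {1..l - 1}" "x \<notin> {u + 1..d}"
        using * x assms by (auto simp: disjoint_iff)
      ultimately show "x \<in> {l..u}" by auto
    qed
  qed
  then show ?T by (auto simp: range_body_def)
  define X where "X v' = {x. \<exists>l' u'. Neg (R v' l' u') \<in> range_body d v l u \<and> x \<in> {l'..u'}}" for v'
  have U: "X v = {1..d} - {l..u}"
  proof (rule set_eqI)
    fix x
    have "x \<in> X v \<longleftrightarrow> (1 < l \<and> x \<in> {1..l - 1}) \<or> (u < d \<and> x \<in> {u + 1..d})"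
      unfolding X_def range_body_def by auto
    then show "x \<in> X v \<longleftrightarrow> x \<in> {1..d} - {l..u}" using assms(2-4) by auto
  qed
  have "(\<exists>v'\<in>V. \<exists>l' u'. Neg (R v' l' u') \<in> range_body d v l u \<and> E v' \<subseteq> X v') \<longleftrightarrow>
     range_body d v l u \<noteq> {} \<and> E v \<subseteq> {1..d} - {l..u}"
    unfolding U[symmetric] using assms(1) by (auto simp: range_body_def)
  moreover have disj: "E v \<subseteq> {1..d} - {l..u} \<longleftrightarrow> E v \<inter> {l..u} = {}"
    using assms by blast
  \<comment> \<open>The clause for a false body asks for at least one literal. The body is empty
    only for \<open>l = 1\<close> and \<open>u = d\<close>, and then a nonempty \<open>E v\<close>
    cannot avoid the interval.\<close>
  moreover have "range_body d v l u \<noteq> {}" if "E v \<inter> {l..u} = {}"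
  proof
    assume "range_body d v l u = {}"
    then have "{1..d} - {l..u} = {}" using U by (auto simp: X_def)
    then show False using disj that assms(5) by auto
  qed
  moreover have "range_approx d V E (Fls (Body (range_body d v l u))) \<longleftrightarrow>
      (\<exists>v'\<in>V. \<exists>l' u'. Neg (R v' l' u') \<in> range_body d v l u \<and> E v' \<subseteq> X v')"
  proof -
    have "Pos a \<notin> range_body d v l u" "Neg Sat \<notin> range_body d v l u" for a
      by (auto simp: range_body_def)
    then show ?thesis unfolding range_approx.simps X_def by simp
  qed
  ultimately show ?F by argo
qed

section \<open>Rules, nogoods and conflict regions of the encoding\<close>

lemma rule_cases:
  assumes "r \<in> range_encoding d c"
  obtains
    (range) v l u where "v \<in> set (scope c)" "1 \<le> l" "l \<le> u" "u \<le> d"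
      "r = Rule (R v l u) (range_body d v l u)"
  | (left) v l u where "v \<in> set (scope c)" "1 < l" "l \<le> u" "u \<le> d"
      "r = Rule Bot {Pos (R v l u), Neg (R v (l - 1) u)}"
  | (right) v l u where "v \<in> set (scope c)" "1 \<le> l" "l \<le> u" "u < d"
      "r = Rule Bot {Pos (R v l u), Neg (R v l (u + 1))}"
  | (sat) "r = Rule Sat {Neg Violate}"
  | (violate) "r = Rule Violate {Neg Sat}"
  | (region) l u where "conflict_region d c l u"
      "r = Rule Violate {Pos (R (scope c ! i) (l i) (u i)) | i. i < length (scope c)}"
proof -
  from assms consider (var) v where "v \<in> set (scope c)" "r \<in> var_rules d v"
    | "r = Rule Sat {Neg Violate}" | "r = Rule Violate {Neg Sat}"
    | "\<exists>l u. r = Rule Violate {Pos (R (scope c ! i) (l i) (u i)) | i. i < length (scope c)} \<and>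
        conflict_region d c l u"
    unfolding range_encoding_def by (elim UnE UN_E insertE emptyE CollectE) simp_all
  then show thesis
  proof cases
    case (var v)
    from var(2) show thesis
      unfolding var_rules_def
      by (elim UnE CollectE exE conjE) (use var(1) range left right in simp_all)
  qed (use sat violate region in \<open>simp, simp, elim exE conjE, simp\<close>)
qed

lemma hull_subset_atLeastAtMost:
  assumes "A \<subseteq> {l..u}"
  shows "hull A \<subseteq> {l..u}"
proof (cases "A = {}")
  case False
  then have "Min A \<in> A" "Max A \<in> A"
    using finite_subset[OF assms] by auto
  then have "l \<le> Min A" "Max A \<le> u" using assms by auto
  then show ?thesis by (auto simp: hull_def)
qed (simp add: hull_def)

text \<open>The only step that uses range consistency: a conflict region that contains the hulls of all
  domains but one is disjoint from the remaining domain.\<close>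

lemma conflict_region_disjoint:
  assumes rc: "range_consistent c E" and region: "conflict_region d c l u"
    and i: "i < length (scope c)"
    and sub: "\<And>j. \<lbrakk>j < length (scope c); j \<noteq> i\<rbrakk> \<Longrightarrow> E (scope c ! j) \<subseteq> {l j..u j}"
  shows "E (scope c ! i) \<inter> {l i..u i} = {}"
proof (rule ccontr)
  assume "\<not> ?thesis"
  then obtain a where a: "a \<in> E (scope c ! i)" "a \<in> {l i..u i}" by blast
  obtain t where t: "bound_support c E i a t"
    using rc i a unfolding range_consistent_def by blast
  have "t ! j \<in> {l j..u j}" if j: "j < length (scope c)" for j
  proof (cases "j = i")
    case False
    then show ?thesis
      using hull_subset_atLeastAtMost[OF sub[OF j False]] t j by (auto simp: bound_support_def)
  qed (use a t in \<open>simp add: bound_support_def\<close>)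
  then show False using region t unfolding conflict_region_def bound_support_def by blast
qed

lemma lit_holds_inject [simp]: "lit_holds l = lit_holds l' \<longleftrightarrow> l = l'"
  by (cases l; cases l') auto

lemma range_rule_in_encoding:
  assumes "v \<in> set (scope c)" "1 \<le> l" "l \<le> u" "u \<le> d"
  shows "Rule (R v l u) (range_body d v l u) \<in> range_encoding d c"
proof -
  have "Rule (R v l u) (range_body d v l u) \<in> var_rules d v"
    unfolding var_rules_def using assms(2-4) by (intro UnI1 CollectI exI conjI) (rule refl)
  then show ?thesis
    unfolding range_encoding_def by (intro UnI1 UN_I[OF assms(1)])
qed

lemma nogood_cases:
  assumes "g \<in> nogoods P"
  obtains
    (lits) r where "r \<in> P" "g = insert (Fls (Body (body r))) (lit_holds ` body r)"
  | (lit) r l where "r \<in> P" "l \<in> body r" "g = {Tru (Body (body r)), complement (lit_holds l)}"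
  | (head) r where "r \<in> P" "g = {Tru (Body (body r)), Fls (Atom (head r))}"
  | (support) a where "g = insert (Tru (Atom a)) {Fls (Body (body r)) | r. r \<in> P \<and> head r = a}"
  | (bot) "g = {Tru (Atom Bot)}"
  using assms unfolding nogoods_def body_nogoods_def
  by (elim UnE UN_E CollectE exE conjE singletonE) (use lits lit head support bot in simp_all)

lemma complement_complement [simp]: "complement (complement s) = s"
  by (cases s) auto

section \<open>Closure of the approximation under unit-propagation\<close>

locale range_consistent_family =
  fixes d :: nat and c :: "'v constr" and E :: "'v \<Rightarrow> nat set"
  assumes scope_nonempty: "scope c \<noteq> []"
    and consistent: "range_consistent c E"
    and nonempty: "v \<in> set (scope c) \<Longrightarrow> E v \<noteq> {}"
    and bounded: "v \<in> set (scope c) \<Longrightarrow> E v \<subseteq> {1..d}"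
begin

abbreviation approx :: "'v signed \<Rightarrow> bool" where
  "approx \<equiv> range_approx d (set (scope c)) E"

lemma approx_range_body:
  assumes "v \<in> set (scope c)" "1 \<le> l" "l \<le> u" "u \<le> d"
  shows "approx (Tru (Body (range_body d v l u))) \<longleftrightarrow> E v \<subseteq> {l..u}"
    and "approx (Fls (Body (range_body d v l u))) \<longleftrightarrow> E v \<inter> {l..u} = {}"
  by (rule range_approx_range_body; use assms nonempty bounded in blast)+

text \<open>The premise compares atoms rather than positions because a body is a set of literals. As
  the scope is distinct, different positions carry different atoms, and
  \<open>conflict_region_disjoint\<close> applies.\<close>

lemma approx_region_literal:
  assumes region: "conflict_region d c l u" and i: "i < length (scope c)"
    and lits: "\<And>j. \<lbrakk>j < length (scope c); R (scope c ! j) (l j) (u j) \<noteq> R (scope c ! i) (l i) (u i)\<rbrakk> \<Longrightarrow>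
      approx (Tru (Atom (R (scope c ! j) (l j) (u j))))"
    and distinct: "distinct (scope c)"
  shows "approx (Fls (Atom (R (scope c ! i) (l i) (u i))))"
proof -
  have "E (scope c ! j) \<subseteq> {l j..u j}" if j: "j < length (scope c)" "j \<noteq> i" for j
  proof -
    have "scope c ! j \<noteq> scope c ! i" using j i distinct by (simp add: nth_eq_iff_index_eq)
    then have "approx (Tru (Atom (R (scope c ! j) (l j) (u j))))" using lits[OF j(1)] by simp
    then show ?thesis by simp
  qed
  from conflict_region_disjoint[OF consistent region i this] show ?thesis by simp
qed

text \<open>For a range rule, head and body are false under the same condition. The other rules with
  a false head contain a positive literal or \<open>Neg Sat\<close>, which makes their bodies false
  outright; for regions this uses that the scope is nonempty.\<close>

lemma approx_head_false:
  assumes "r \<in> range_encoding d c" "approx (Fls (Atom (head r)))"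
  shows "approx (Fls (Body (body r)))"
  using assms(1)
proof (cases rule: rule_cases)
  case (range v l u)
  then show ?thesis using assms(2) approx_range_body(2)[OF range(1-4)]
    by (simp del: range_approx.simps(10))
next
  case region
  then show ?thesis using scope_nonempty by auto
qed (use assms(2) in auto)

lemma approx_body_true:
  assumes "r \<in> range_encoding d c" "approx (Tru (Body (body r)))"
  shows "approx (Tru (Atom (head r)))"
  using assms(1)
proof (cases rule: rule_cases)
  case (range v l u)
  then show ?thesis using assms(2) approx_range_body(1)[OF range(1-4)]
    by (simp del: range_approx.simps(9))
next
  case region
  then show ?thesis using assms(2) scope_nonempty by auto
qed (use assms(2) in auto)

lemma approx_body_lit:
  assumes "approx (Tru (Body B))" "l \<in> B"
  shows "approx (lit_holds l)"
proof -
  have "l \<in> insert (Neg Violate) {Neg (R v l u) | v l u. E v \<inter> {l..u} = {}}"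
    using assms unfolding range_approx.simps by blast
  then show ?thesis by auto
qed

text \<open>If the falsified literal negates \<open>R v l u\<close>, then \<open>E v\<close> already
  lies inside this single negated interval, hence inside the union of all of them.\<close>

lemma approx_lit_false:
  assumes "approx (complement (lit_holds l))" "l \<in> B"
  shows "approx (Fls (Body B))"
proof (cases l)
  case (Pos a)
  then show ?thesis using assms by auto
next
  case (Neg a)
  then show ?thesis
  proof (cases a)
    case (R v l u)
    then have "v \<in> set (scope c)" "E v \<subseteq> {l..u}" "Neg (R v l u) \<in> B"
      using Neg assms by auto
    then show ?thesis unfolding range_approx.simps by blast
  qed (use Neg assms in auto)
qed

text \<open>Only range rules and the rule for \<open>Sat\<close> can have all literals true. In the
  other bodies this would be contradictory: a nonempty domain cannot lie in an interval and avoid a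
  larger one, and the true atoms of a region would make one of them false.\<close>

lemma approx_lits_true:
  assumes "r \<in> range_encoding d c" "distinct (scope c)"
    and lits: "\<And>l. l \<in> body r \<Longrightarrow> approx (lit_holds l)"
  shows "approx (Tru (Body (body r)))"
  using assms(1)
proof (cases rule: rule_cases)
  case (range v l u)
  have "E v \<inter> {1..l - 1} = {}" if "1 < l"
    using lits[of "Neg (R v 1 (l - 1))"] range that by (auto simp: range_body_def)
  moreover have "E v \<inter> {u + 1..d} = {}" if "u < d"
    using lits[of "Neg (R v (u + 1) d)"] range that by (auto simp: range_body_def)
  ultimately show ?thesis using range(5) by (auto simp: range_body_def)
next
  case (left v l u)
  then have "E v \<subseteq> {l..u}" "E v \<inter> {l - 1..u} = {}"
    using lits[of "Pos (R v l u)"] lits[of "Neg (R v (l - 1) u)"] by auto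
  then show ?thesis using nonempty[OF left(1)] by fastforce
next
  case (right v l u)
  then have "E v \<subseteq> {l..u}" "E v \<inter> {l..u + 1} = {}"
    using lits[of "Pos (R v l u)"] lits[of "Neg (R v l (u + 1))"] by auto
  then show ?thesis using nonempty[OF right(1)] by fastforce
next
  case (region l u)
  have T: "approx (Tru (Atom (R (scope c ! i) (l i) (u i))))" if "i < length (scope c)" for i
    using lits[of "Pos (R (scope c ! i) (l i) (u i))"] region that by auto
  \<comment> \<open>Position 0 serves as the one whose atom is forced false by all the
    others.\<close>
  have 0: "0 < length (scope c)" using scope_nonempty by simp
  show ?thesis
    using range_approx_consistent[OF T[OF 0] approx_region_literal[OF region(1) 0 T assms(2)] nonempty]
    by blast
next
  case violate
  then show ?thesis using lits[of "Neg Sat"] by auto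
qed simp

text \<open>In a range rule the domain avoids \<open>{l..u}\<close> and one of its two sides, so it
  lies in the other side. For the rules with head \<open>Bot\<close> the claim is monotonicity in
  the interval, and for regions it is \<open>approx_region_literal\<close>.\<close>

lemma approx_literal:
  assumes "r \<in> range_encoding d c" "distinct (scope c)" "approx (Fls (Body (body r)))"
    and x: "x \<in> body r"
    and lits: "\<And>y. \<lbrakk>y \<in> body r; y \<noteq> x\<rbrakk> \<Longrightarrow> approx (lit_holds y)"
  shows "approx (complement (lit_holds x))"
  using assms(1)
proof (cases rule: rule_cases)
  case (range v l u)
  then have disj: "E v \<inter> {l..u} = {}"
    using assms(3) by (simp add: approx_range_body del: range_approx.simps(10))
  consider "x = Neg (R v 1 (l - 1))" "1 < l" | "x = Neg (R v (u + 1) d)" "u < d"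
    using x range by (auto simp: range_body_def split: if_splits)
  then show ?thesis
  proof cases
    case 1
    have "E v \<inter> {u + 1..d} = {}" if "u < d"
      using lits[of "Neg (R v (u + 1) d)"] range 1 that by (auto simp: range_body_def)
    \<comment> \<open>For \<open>u = d\<close> there is no such literal, but the interval is
      empty.\<close>
    then have "E v \<inter> {u + 1..d} = {}" by (cases "u < d") auto
    then have "E v \<subseteq> {1..l - 1}"
      using disj bounded[OF range(1)] by (fastforce simp: disjoint_iff)
    then show ?thesis using 1 range by auto
  next
    case 2
    have "E v \<inter> {1..l - 1} = {}" if "1 < l"
      using lits[of "Neg (R v 1 (l - 1))"] range 2 that by (auto simp: range_body_def)
    then have "E v \<inter> {1..l - 1} = {}" by (cases "1 < l") auto
    then have "E v \<subseteq> {u + 1..d}"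
      using disj bounded[OF range(1)] by (fastforce simp: disjoint_iff)
    then show ?thesis using 2 range by auto
  qed
next
  case (left v l u)
  consider "x = Pos (R v l u)" | "x = Neg (R v (l - 1) u)" using x left by auto
  then show ?thesis
  proof cases
    case 1
    then have "E v \<inter> {l - 1..u} = {}" using lits[of "Neg (R v (l - 1) u)"] left by auto
    then show ?thesis using 1 left by fastforce
  next
    case 2
    then have "E v \<subseteq> {l..u}" using lits[of "Pos (R v l u)"] left by auto
    then show ?thesis using 2 left by fastforce
  qed
next
  case (right v l u)
  consider "x = Pos (R v l u)" | "x = Neg (R v l (u + 1))" using x right by auto
  then show ?thesis
  proof cases
    case 1
    then have "E v \<inter> {l..u + 1} = {}" using lits[of "Neg (R v l (u + 1))"] right by auto
    then show ?thesis using 1 right by fastforce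
  next
    case 2
    then have "E v \<subseteq> {l..u}" using lits[of "Pos (R v l u)"] right by auto
    then show ?thesis using 2 right by fastforce
  qed
next
  case sat
  then show ?thesis using assms(3) by auto
next
  case violate
  then show ?thesis using x by auto
next
  case (region l u)
  then obtain i where i: "i < length (scope c)" "x = Pos (R (scope c ! i) (l i) (u i))"
    using x by auto
  have "approx (Fls (Atom (R (scope c ! i) (l i) (u i))))"
  proof (rule approx_region_literal[OF region(1) i(1) _ assms(2)])
    fix j assume "j < length (scope c)" "R (scope c ! j) (l j) (u j) \<noteq> R (scope c ! i) (l i) (u i)"
    then show "approx (Tru (Atom (R (scope c ! j) (l j) (u j))))"
      using lits[of "Pos (R (scope c ! j) (l j) (u j))"] region i by auto
  qed
  then show ?thesis using i by simp
qed

lemma approx_closed: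
  assumes "distinct (scope c)" and g: "g \<in> nogoods (range_encoding d c)" "s \<in> g"
    and rest: "\<And>s'. s' \<in> g - {s} \<Longrightarrow> approx s'"
  shows "approx (complement s)"
proof -
  \<comment> \<open>A two-element nogood can propagate in either direction.\<close>
  have pair: "s = p \<and> approx q \<or> s = q \<and> approx p" if "g = {p, q}" "p \<noteq> q" for p q
    using g(2) rest[of p] rest[of q] that by auto
  from g(1) show ?thesis
  proof (cases rule: nogood_cases)
    case (lits r)
    show ?thesis
    proof (cases "s = Fls (Body (body r))")
      case True
      have "approx (lit_holds l)" if "l \<in> body r" for l
      proof (rule rest)
        have "lit_holds l \<noteq> s" using True by (cases l) auto
        then show "lit_holds l \<in> g - {s}" using lits(2) that by simp
      qed
      from approx_lits_true[OF lits(1) assms(1) this] show ?thesis using True by simp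
    next
      case False
      then obtain x where x: "x \<in> body r" "s = lit_holds x" using g lits by auto
      have "approx (lit_holds y)" if "y \<in> body r" "y \<noteq> x" for y
        by (rule rest) (use lits(2) that x in auto)
      moreover have "approx (Fls (Body (body r)))"
        by (rule rest) (use lits(2) False in auto)
      ultimately show ?thesis
        using approx_literal[OF lits(1) assms(1) _ x(1)] x(2) by blast
    qed
  next
    case (lit r l)
    have "Tru (Body (body r)) \<noteq> complement (lit_holds l)" by (cases l) auto
    from pair[OF lit(3) this] show ?thesis
      using approx_lit_false[OF _ lit(2)] approx_body_lit[OF _ lit(2)]
      by (elim disjE conjE) (simp_all del: range_approx.simps)
  next
    case (head r)
    have "Tru (Body (body r)) \<noteq> Fls (Atom (head r))" by simp
    from pair[OF head(2) this] show ?thesis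
      using approx_head_false[OF head(1)] approx_body_true[OF head(1)]
      by (elim disjE conjE) (simp_all del: range_approx.simps)
  next
    case (support a)
    show ?thesis
    proof (cases "s = Tru (Atom a)")
      case True
      have supp: "approx (Fls (Body B))" if "Rule a B \<in> range_encoding d c" for B
        by (rule rest) (use support True that in force)
      show ?thesis
      \<comment> \<open>An atom \<open>R v l u\<close> without a rule is false by definition, and
        otherwise its range rule has a false body. For \<open>Sat\<close> the premise is
        contradictory, since \<open>{Neg Violate}\<close> is not a false body.\<close>
      proof (cases a)
        case (R v l u)
        have "E v \<inter> {l..u} = {}" if "v \<in> set (scope c)" "1 \<le> l" "l \<le> u" "u \<le> d"
          using supp[of "range_body d v l u"] range_rule_in_encoding[OF that] R approx_range_body(2)[OF that]
          by simp
        then show ?thesis using True R by auto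
      next
        case Sat
        have "Rule Sat {Neg Violate} \<in> range_encoding d c" by (simp add: range_encoding_def)
        then have "approx (Fls (Body {Neg Violate}))" using supp[of "{Neg Violate}"] Sat by simp
        then show ?thesis by simp
      qed (use True in auto)
    next
      case False
      then obtain r where r: "r \<in> range_encoding d c" "head r = a" "s = Fls (Body (body r))"
        using g support by auto
      \<comment> \<open>A true \<open>a\<close> is \<open>Sat\<close> or an interval atom that
        contains its domain, and the body of a rule for such a head is true.\<close>
      have a: "approx (Tru (Atom a))" by (rule rest) (use support False in auto)
      show ?thesis
        using r(1)
      proof (cases rule: rule_cases)
        case (range v l u)
        then have "a = R v l u" using r(2) by simp
        then have "E v \<subseteq> {l..u}" using a by simp
        then have "approx (Tru (Body (range_body d v l u)))"
          by (simp only: approx_range_body(1)[OF range(1-4)])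
        then show ?thesis using r range by (simp del: range_approx.simps)
      qed (use r a in auto)
    qed
  next
    case bot
    then show ?thesis using g by auto
  qed
qed

lemma approx_unit_prop:
  assumes "distinct (scope c)" "\<And>v. v \<in> set (scope c) \<Longrightarrow> E v \<subseteq> D v"
  shows "unit_prop (nogoods (range_encoding d c)) (initial d c D) \<subseteq> Collect approx"
proof (rule unit_prop_subset)
  show "initial d c D \<subseteq> Collect approx"
    unfolding initial_def using assms(2) by fastforce
next
  fix g s
  assume g: "g \<in> nogoods (range_encoding d c)" "s \<in> g" and rest: "g - {s} \<subseteq> Collect approx"
  have "approx s'" if "s' \<in> g - {s}" for s' using rest that by (simp add: subset_iff)
  from approx_closed[OF assms(1) g this] show "complement s \<in> Collect approx" by simp
qed

text \<open>If a nogood held entirely, closure applied to any of its elements would put the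
  complement of that element into the approximation too, against consistency.\<close>

lemma no_conflict:
  assumes "distinct (scope c)" "\<And>v. v \<in> set (scope c) \<Longrightarrow> E v \<subseteq> D v"
  shows "\<not> conflict (nogoods (range_encoding d c)) (unit_prop (nogoods (range_encoding d c)) (initial d c D))"
proof
  assume "conflict (nogoods (range_encoding d c)) (unit_prop (nogoods (range_encoding d c)) (initial d c D))"
  then obtain g where g: "g \<in> nogoods (range_encoding d c)" "g \<subseteq> Collect approx"
    using approx_unit_prop[OF assms] unfolding conflict_def by blast
  obtain s where s: "s \<in> g" using g(1) by (cases rule: nogood_cases) auto
  have approx: "approx s'" if "s' \<in> g" for s' using g(2) that by (simp add: subset_iff)
  then have "approx s" using s .
  moreover have "approx (complement s)" by (rule approx_closed[OF assms(1) g(1) s]) (simp add: approx)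
  ultimately obtain x where "approx (Tru x)" "approx (Fls x)" by (cases s) auto
  from range_approx_consistent[OF this nonempty] show False .
qed

end

section \<open>Completeness\<close>

locale conflict_free =
  fixes d :: nat and c :: "'v constr" and D :: "'v \<Rightarrow> nat set" and A :: "'v signed set"
  defines "A \<equiv> unit_prop (nogoods (range_encoding d c)) (initial d c D)"
  assumes no_conflict: "\<not> conflict (nogoods (range_encoding d c)) A"
begin

lemma A_consistent: "Tru x \<in> A \<Longrightarrow> Fls x \<in> A \<Longrightarrow> False"
  using conflict_if_inconsistent[of x "nogoods (range_encoding d c)" "initial d c D"] no_conflict
  by (auto simp: A_def initial_def)

section \<open>Propagation through the rule of one interval atom\<close>

context
  fixes v l u
  assumes v: "v \<in> set (scope c)" and lu: "1 \<le> l" "l \<le> u" "u \<le> d"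
begin

private lemma rule_in: "Rule (R v l u) (range_body d v l u) \<in> range_encoding d c"
  using v lu by (rule range_rule_in_encoding)

lemma R_true:
  assumes "1 < l \<Longrightarrow> Fls (Atom (R v 1 (l - 1))) \<in> A" "u < d \<Longrightarrow> Fls (Atom (R v (u + 1) d)) \<in> A"
  shows "Tru (Atom (R v l u)) \<in> A"
proof -
  have "lit_holds x \<in> A" if "x \<in> range_body d v l u" for x
    using that assms by (auto simp: range_body_def split: if_splits)
  then show ?thesis using unit_prop_head[OF rule_in] by (simp add: A_def)
qed

text \<open>The range rule is the only rule with head \<open>R v l u\<close>, so placing
  \<open>v\<close> entirely on one side of the interval removes all support.\<close>

lemma R_false:
  assumes "(1 < l \<and> Tru (Atom (R v 1 (l - 1))) \<in> A) \<or> (u < d \<and> Tru (Atom (R v (u + 1) d)) \<in> A)"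
  shows "Fls (Atom (R v l u)) \<in> A"
proof -
  have uniq: "r = Rule (R v l u) (range_body d v l u)"
    if "r \<in> range_encoding d c" "head r = R v l u" for r
    using that(1) by (cases rule: rule_cases) (use that(2) in auto)
  have "Fls (Atom (R v l u)) \<in> A"
    if "x \<in> range_body d v l u" "complement (lit_holds x) \<in> A" for x
    using unit_prop_unsupported[OF rule_in, of x "initial d c D"] uniq that by (simp add: A_def)
  from this[of "Neg (R v 1 (l - 1))"] this[of "Neg (R v (u + 1) d)"] show ?thesis
    using assms by (auto simp: range_body_def)
qed

lemma R_above:
  assumes "Fls (Atom (R v l u)) \<in> A" "1 < l \<Longrightarrow> Fls (Atom (R v 1 (l - 1))) \<in> A" "u < d"
  shows "Tru (Atom (R v (u + 1) d)) \<in> A"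
proof -
  have "lit_holds x \<in> A" if "x \<in> range_body d v l u" "x \<noteq> Neg (R v (u + 1) d)" for x
    using that assms(2) by (auto simp: range_body_def split: if_splits)
  moreover have "Neg (R v (u + 1) d) \<in> range_body d v l u" using assms(3) by (simp add: range_body_def)
  ultimately show ?thesis
    using unit_prop_literal[OF rule_in, of "initial d c D" "Neg (R v (u + 1) d)"] assms(1)
    by (simp add: A_def)
qed

lemma R_below:
  assumes "Fls (Atom (R v l u)) \<in> A" "u < d \<Longrightarrow> Fls (Atom (R v (u + 1) d)) \<in> A" "1 < l"
  shows "Tru (Atom (R v 1 (l - 1))) \<in> A"
proof -
  have "lit_holds x \<in> A" if "x \<in> range_body d v l u" "x \<noteq> Neg (R v 1 (l - 1))" for x
    using that assms(2) by (auto simp: range_body_def split: if_splits)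
  moreover have "Neg (R v 1 (l - 1)) \<in> range_body d v l u" using assms(3) by (simp add: range_body_def)
  ultimately show ?thesis
    using unit_prop_literal[OF rule_in, of "initial d c D" "Neg (R v 1 (l - 1))"] assms(1)
    by (simp add: A_def)
qed

end

text \<open>The values that survive propagation. The family is empty outside the scope so that it
  lies below \<open>D\<close> at every variable.\<close>

definition F :: "'v \<Rightarrow> nat set" where
  "F v = (if v \<in> set (scope c) then {i \<in> {1..d}. Fls (Atom (R v i i)) \<notin> A} else {})"

section \<open>Interval atoms at the bounds of the surviving values\<close>

lemma F_iff: "v \<in> set (scope c) \<Longrightarrow> i \<in> F v \<longleftrightarrow> 1 \<le> i \<and> i \<le> d \<and> Fls (Atom (R v i i)) \<notin> A"
  by (auto simp: F_def)

lemma finite_F [simp]: "finite (F v)"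
  by (simp add: F_def)

text \<open>Walk upwards: once \<open>v\<close> is neither in \<open>{1..k}\<close> nor equal to
  \<open>k + 1\<close>, the rule for the singleton \<open>k + 1\<close> makes
  \<open>R v (k + 2) d\<close> true, and this falsifies \<open>R v 1 (k + 1)\<close>.\<close>

lemma R_prefix_false:
  assumes v: "v \<in> set (scope c)"
  shows "\<lbrakk>1 \<le> k; k \<le> d; F v \<inter> {1..k} = {}\<rbrakk> \<Longrightarrow> Fls (Atom (R v 1 k)) \<in> A"
proof (induction k)
  case (Suc k)
  have fls: "Fls (Atom (R v (Suc k) (Suc k))) \<in> A"
    using Suc.prems F_iff[OF v, of "Suc k"] by (auto simp: disjoint_iff)
  have pre: "Fls (Atom (R v 1 k)) \<in> A" if "1 \<le> k"
    by (rule Suc.IH) (use Suc.prems that in \<open>auto simp: disjoint_iff\<close>)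
  show ?case
  proof (cases "Suc k < d")
    case True
    then have "Tru (Atom (R v (Suc k + 1) d)) \<in> A"
      using R_above[OF v _ _ _ fls] pre by simp
    then show ?thesis using R_false[OF v, of 1 "Suc k"] True by simp
  next
    case False
    \<comment> \<open>Here \<open>Suc k = d\<close>, so no value is left above; the singleton
      becomes true although it is excluded.\<close>
    then have "Tru (Atom (R v (Suc k) (Suc k))) \<in> A"
      by (intro R_true[OF v]) (use False pre Suc.prems in auto)
    then show ?thesis using A_consistent fls by blast
  qed
qed simp

lemma F_nonempty:
  assumes v: "v \<in> set (scope c)" and "1 \<le> d"
  shows "F v \<noteq> {}"
proof
  assume "F v = {}"
  then have "Fls (Atom (R v 1 d)) \<in> A" using R_prefix_false[OF v] assms(2) by simp
  \<comment> \<open>The rule for the full interval has an empty body.\<close>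
  moreover have "Tru (Atom (R v 1 d)) \<in> A" using R_true[OF v, of 1 d] assms(2) by simp
  ultimately show False using A_consistent by blast
qed

text \<open>The mirror image, walking down from \<open>d\<close>. The bound \<open>1 < k\<close>
  ensures that \<open>R v 1 (k - 1)\<close>, through which each step passes, belongs to the
  encoding.\<close>

lemma R_suffix_false:
  assumes v: "v \<in> set (scope c)" and "1 < k" "k \<le> d" "F v \<inter> {k..d} = {}"
  shows "Fls (Atom (R v k d)) \<in> A"
  using assms(3,2,4)
proof (induction rule: inc_induct)
  case base
  then show ?case using F_iff[OF v, of d] by auto
next
  case (step k)
  have "Fls (Atom (R v k k)) \<in> A"
    using step F_iff[OF v, of k] by (auto simp: disjoint_iff)
  moreover have "Fls (Atom (R v (k + 1) d)) \<in> A"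
    using step by (auto simp: disjoint_iff)
  ultimately have "Tru (Atom (R v 1 (k - 1))) \<in> A"
    using R_below[OF v, of k k] step by simp
  then show ?case using R_false[OF v, of k d] step by simp
qed

text \<open>No value survives below the minimum or above the maximum, so both body literals of the
  rule for this interval hold.\<close>

lemma R_hull_true:
  assumes v: "v \<in> set (scope c)" and "1 \<le> d"
  shows "Tru (Atom (R v (Min (F v)) (Max (F v)))) \<in> A"
proof (rule R_true[OF v])
  note ne = F_nonempty[OF assms]
  have mem: "Min (F v) \<in> F v" "Max (F v) \<in> F v" using ne by simp_all
  then show "1 \<le> Min (F v)" "Max (F v) \<le> d" using F_iff[OF v] by blast+
  show "Min (F v) \<le> Max (F v)" using mem by (simp add: Min_le)
  show "Fls (Atom (R v 1 (Min (F v) - 1))) \<in> A" if "1 < Min (F v)"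
  proof (rule R_prefix_false[OF v])
    show "F v \<inter> {1..Min (F v) - 1} = {}"
    proof -
      have "x \<notin> {1..Min (F v) - 1}" if "x \<in> F v" for x
        using Min_le[OF finite_F that] \<open>1 < Min (F v)\<close> by auto
      then show ?thesis by blast
    qed
    show "Min (F v) - 1 \<le> d" using F_iff[OF v, of "Min (F v)"] mem by linarith
  qed (use that in simp)
  show "Fls (Atom (R v (Max (F v) + 1) d)) \<in> A" if "Max (F v) < d"
  proof (rule R_suffix_false[OF v])
    show "F v \<inter> {Max (F v) + 1..d} = {}"
    proof -
      have "x \<notin> {Max (F v) + 1..d}" if "x \<in> F v" for x
        using Max_ge[OF finite_F that] by auto
      then show ?thesis by blast
    qed
    show "1 < Max (F v) + 1" using F_iff[OF v, of "Max (F v)"] mem by simp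
  qed (use that in simp)
qed

text \<open>\<open>Violate\<close> is false from the start, so the region rule propagates backwards
  to its last open literal.\<close>

lemma region_blocked:
  assumes "conflict_region d c l u" "i < length (scope c)"
    and "\<And>j. \<lbrakk>j < length (scope c); j \<noteq> i\<rbrakk> \<Longrightarrow> Tru (Atom (R (scope c ! j) (l j) (u j))) \<in> A"
  shows "Fls (Atom (R (scope c ! i) (l i) (u i))) \<in> A"
proof -
  let ?r = "Rule Violate {Pos (R (scope c ! i) (l i) (u i)) | i. i < length (scope c)}"
  have r: "?r \<in> range_encoding d c" using assms(1) unfolding range_encoding_def by blast
  have "Fls (Atom (head ?r)) \<in> A"
    unfolding A_def by (rule unit_prop.init) (simp add: initial_def)
  then show ?thesis
    using unit_prop_literal[OF r, of "initial d c D" "Pos (R (scope c ! i) (l i) (u i))"] assms(2,3)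
    by (force simp: A_def)
qed

lemma F_range_consistent:
  assumes "1 \<le> d"
  shows "range_consistent c F"
  unfolding range_consistent_def
proof (intro allI impI ballI, rule ccontr)
  fix i a assume i: "i < length (scope c)" and a: "a \<in> F (scope c ! i)"
    and none: "\<nexists>t. bound_support c F i a t"
  have F_iff: "x \<in> F (scope c ! j) \<longleftrightarrow> 1 \<le> x \<and> x \<le> d \<and> Fls (Atom (R (scope c ! j) x x)) \<notin> A"
    and ne: "F (scope c ! j) \<noteq> {}" if "j < length (scope c)" for j x
    using F_iff F_nonempty assms that by simp_all
  \<comment> \<open>The box consists of the single value \<open>a\<close> at position
    \<open>i\<close> and of the hulls elsewhere. An allowed tuple in it would be precisely a bound
    support for \<open>a\<close>.\<close>
  let ?l = "\<lambda>j. if j = i then a else Min (F (scope c ! j))"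
  let ?u = "\<lambda>j. if j = i then a else Max (F (scope c ! j))"
  have "conflict_region d c ?l ?u"
    unfolding conflict_region_def
  proof (intro conjI allI impI)
    fix j assume j: "j < length (scope c)"
    have mem: "Min (F (scope c ! j)) \<in> F (scope c ! j)" "Max (F (scope c ! j)) \<in> F (scope c ! j)"
      using ne[OF j] by simp_all
    then have "Min (F (scope c ! j)) \<le> Max (F (scope c ! j))" by (simp add: Min_le)
    then show "1 \<le> ?l j" "?l j \<le> ?u j" "?u j \<le> d"
      using mem a F_iff[OF i] F_iff[OF j] by auto
  next
    show "\<not> (\<exists>t\<in>allowed c. \<forall>j<length (scope c). t ! j \<in> {?l j..?u j})"
    proof
      assume "\<exists>t\<in>allowed c. \<forall>j<length (scope c). t ! j \<in> {?l j..?u j}"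
      then obtain t where t: "t \<in> allowed c" "\<And>j. j < length (scope c) \<Longrightarrow> t ! j \<in> {?l j..?u j}"
        by blast
      then have "bound_support c F i a t"
        using i t(2)[OF i] ne unfolding bound_support_def by (fastforce simp: hull_def)
      then show False using none by blast
    qed
  qed
  then have "Fls (Atom (R (scope c ! i) a a)) \<in> A"
    using region_blocked[of ?l ?u i] R_hull_true[OF nth_mem assms] i by simp
  then show False using a F_iff[OF i] by blast
qed

lemma F_le:
  assumes "\<And>v. v \<in> set (scope c) \<Longrightarrow> D v \<subseteq> {1..d}"
  shows "F \<le> D"
proof (rule le_funI, rule subsetI)
  fix v i assume i: "i \<in> F v"
  then have v: "v \<in> set (scope c)" by (simp add: F_def split: if_splits)
  show "i \<in> D v"
  proof (rule ccontr)
    assume "i \<notin> D v"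
    then have "Fls (Atom (R v i i)) \<in> A"
      unfolding A_def using i v F_iff[OF v, of i] by (intro unit_prop.init) (simp add: initial_def)
    then show False using i F_iff[OF v] by blast
  qed
qed

end

section \<open>Combination of soundness and completeness\<close>

theorem theorem3:
  fixes d :: nat and c :: "'v constr"
  assumes "wf_constr d c"
  shows "up_enforces_rc d c (range_encoding d c)"
proof -
  have scope: "scope c \<noteq> []" "distinct (scope c)" using assms by (auto simp: wf_constr_def)
  show ?thesis
    unfolding up_enforces_rc_def Let_def
  proof (intro allI impI)
    fix D :: "'v \<Rightarrow> nat set"
    assume D: "\<forall>v\<in>set (scope c). D v \<noteq> {} \<and> D v \<subseteq> {1..d}"
    let ?A = "unit_prop (nogoods (range_encoding d c)) (initial d c D)"
    let ?conflict = "conflict (nogoods (range_encoding d c)) ?A"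
    let ?E = "enforce_rc c D"
    have "finite (D v)" if "v \<in> set (scope c)" for v
      using D that by (meson finite_atLeastAtMost finite_subset)
    note E = enforce_rc_greatest[of c D, OF this]
    have E_sub: "?E v \<subseteq> D v" for v using E(1) by (simp add: le_fun_def)
    \<comment> \<open>The first variable of the scope has a nonempty domain inside
      \<open>{1..d}\<close>.\<close>
    have "1 \<le> d" using D scope(1) by (metis all_not_in_conv atLeastAtMost_iff le_trans list.set_sel(1) subsetD)
    have F_le: "{i \<in> {1..d}. Fls (Atom (R v i i)) \<notin> ?A} \<noteq> {}"
        "{i \<in> {1..d}. Fls (Atom (R v i i)) \<notin> ?A} \<subseteq> ?E v"
      if "\<not> ?conflict" and v: "v \<in> set (scope c)" for v
    proof -
      interpret conflict_free d c D ?A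
        by unfold_locales (use that(1) in auto)
      \<comment> \<open>The surviving values form a range consistent family below \<open>D\<close>,
        so maximality of \<open>?E\<close> applies.\<close>
      have "F \<le> ?E" by (rule E(3)) (use F_le F_range_consistent \<open>1 \<le> d\<close> D in auto)
      then have "F v \<subseteq> ?E v" by (simp only: le_fun_def)
      then show "{i \<in> {1..d}. Fls (Atom (R v i i)) \<notin> ?A} \<noteq> {}"
          "{i \<in> {1..d}. Fls (Atom (R v i i)) \<notin> ?A} \<subseteq> ?E v"
        using F_nonempty[OF v \<open>1 \<le> d\<close>] v unfolding F_def by (simp_all only: if_True not_False_eq_True)
    qed
    have family: "range_consistent_family d c ?E" if "\<forall>v\<in>set (scope c). ?E v \<noteq> {}"
      by unfold_locales (use that scope E(2) E_sub D in blast)+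
    have "?conflict \<longleftrightarrow> (\<exists>v\<in>set (scope c). ?E v = {})"
    proof
      assume ?conflict
      then show "\<exists>v\<in>set (scope c). ?E v = {}"
        using range_consistent_family.no_conflict[OF family scope(2) E_sub] by blast
    next
      assume "\<exists>v\<in>set (scope c). ?E v = {}"
      then show ?conflict using F_le by fastforce
    qed
    moreover have "{i \<in> {1..d}. Fls (Atom (R v i i)) \<notin> ?A} = ?E v"
      if nc: "\<not> ?conflict" and v: "v \<in> set (scope c)" for v
    proof
      \<comment> \<open>Nonempty sets of surviving values inside \<open>?E\<close> make the
        soundness results available for \<open>?E\<close> itself.\<close>
      have "\<forall>v\<in>set (scope c). ?E v \<noteq> {}" using F_le[OF nc] by fastforce
      note sub = range_consistent_family.approx_unit_prop[OF family[OF this] scope(2) E_sub]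
      show "?E v \<subseteq> {i \<in> {1..d}. Fls (Atom (R v i i)) \<notin> ?A}"
      proof
        fix i assume i: "i \<in> ?E v"
        then have id: "i \<in> {1..d}" using E_sub D v by blast
        have "Fls (Atom (R v i i)) \<notin> ?A"
        proof
          assume "Fls (Atom (R v i i)) \<in> ?A"
          then have "range_approx d (set (scope c)) ?E (Fls (Atom (R v i i)))" using sub by blast
          then show False using i id v by auto
        qed
        then show "i \<in> {i \<in> {1..d}. Fls (Atom (R v i i)) \<notin> ?A}" using id by simp
      qed
    qed (rule F_le(2)[OF nc v])
    ultimately show "(?conflict \<longleftrightarrow> (\<exists>v\<in>set (scope c). ?E v = {})) \<and>
      (\<not> ?conflict \<longrightarrow> (\<forall>v\<in>set (scope c). {i \<in> {1..d}. Fls (Atom (R v i i)) \<notin> ?A} = ?E v))"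
      by blast
  qed
qed

end
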